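(* Let $C_1$ and $C_2$ be clones on $\{0,1\}$ such that $C_1 \supseteq K_1$ and $C_2 \supseteq K_2$ for some \[ K_1 \in \{I, V_{0*}, \Lambda_{*1}\}, \qquad K_2 \in \{MU^\infty_{01}, MW^\infty_{01}\}. \] Then there are only finitely many $(C_1,C_2)$-clonoids of Boolean functions.
   Context: A Boolean function is a map $f \colon \{0,1\}^n \to \{0,1\}$ for some integer $n \geq 1$ (its arity). If $f$ is $n$-ary and $g_1,\dots,g_n$ are $m$-ary, then $f(g_1,\dots,g_n)$ is the $m$-ary function $\mathbf{a} \mapsto f(g_1(\mathbf{a}),\dots,g_n(\mathbf{a}))$. For sets $F, G$ of Boolean functions, $FG$ is the set of all composites $f(g_1,\dots,g_n)$ with $f \in F$ of some arity $n$ and $g_1,\dots,g_n \in G$ all of a common arity. A clone on $\{0,1\}$ is a set $C$ of Boolean functions containing all projections and satisfying $CC \subseteq C$. For clones $C_1,C_2$ on $\{0,1\}$, a (possibly empty) set $K$ of Boolean functions is a $(C_1,C_2)$-clonoid if $KC_1 \subseteq K$ and $C_2K \subseteq K$. Notation: $I$ is the clone of all projections and all constant functions. $V$ is the clone generated by $\vee$ and the constants $0,1$; $V_{0*} = \{f \in V : f(0,\dots,0)=0\}$. $\Lambda$ is the clone generated by $\wedge$ and the constants $0,1$; $\Lambda_{*1} = \{f \in \Lambda : f(1,\dots,1)=1\}$. $M$ is the clone of monotone Boolean functions (with respect to the componentwise order induced by $0<1$). $U^\infty$ is the set of all Boolean functions $f$ such that $\bigwedge T \neq (0,\dots,0)$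 for every $T \subseteq f^{-1}(1)$; $W^\infty$ is the set of all $f$ such that $\bigvee F \neq (1,\dots,1)$ for every $F \subseteq f^{-1}(0)$ (componentwise meets and joins, empty meet $=(1,\dots,1)$, empty join $=(0,\dots,0)$). $MU^\infty_{01}$ is the clone of all $f \in M \cap U^\infty$ with $f(0,\dots,0)=0$ and $f(1,\dots,1)=1$; $MW^\infty_{01}$ is the clone of all $f \in M \cap W^\infty$ with $f(0,\dots,0)=0$ and $f(1,\dots,1)=1$. *)

theory Defs
  imports Main "HOL-Library.FuncSet"
begin

text \<open>
  A Boolean function is a pair of its arity \<open>n\<close> and a map on the Boolean lists of length \<open>n\<close>.
  The map is required to be extensional (\<open>undefined\<close> on lists of any other length), so that
  equality of pairs is equality of Boolean functions; without this, a single Boolean function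
  would have infinitely many representatives.
\<close>

type_synonym boolfun = "nat \<times> (bool list \<Rightarrow> bool)"

definition cube :: "nat \<Rightarrow> bool list set" where
  "cube n = {a. length a = n}"

definition boolfuns :: "boolfun set" where
  "boolfuns = {(n, f). n \<ge> 1 \<and> f \<in> extensional (cube n)}"

abbreviation arity :: "boolfun \<Rightarrow> nat" where
  "arity f \<equiv> fst f"

abbreviation app :: "boolfun \<Rightarrow> bool list \<Rightarrow> bool" where
  "app f \<equiv> snd f"

definition mk :: "nat \<Rightarrow> (bool list \<Rightarrow> bool) \<Rightarrow> boolfun" where
  "mk n f = (n, restrict f (cube n))"

definition zeros :: "nat \<Rightarrow> bool list" where
  "zeros n = replicate n False"

definition ones :: "nat \<Rightarrow> bool list" where
  "ones n = replicate n True"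

text \<open>
  \<open>m\<close> is the common arity of the inner functions \<open>gs\<close>. In \<open>comp_set\<close> it is determined by
  \<open>gs\<close>, which is nonempty because arities are positive.
\<close>

definition compose_bf :: "nat \<Rightarrow> boolfun \<Rightarrow> boolfun list \<Rightarrow> boolfun" where
  "compose_bf m f gs = mk m (\<lambda>a. app f (map (\<lambda>g. app g a) gs))"

definition comp_set :: "boolfun set \<Rightarrow> boolfun set \<Rightarrow> boolfun set" where
  "comp_set F G =
     {compose_bf m f gs | m f gs.
        f \<in> F \<and> length gs = arity f \<and> (\<forall>g\<in>set gs. g \<in> G \<and> arity g = m)}"

definition projections :: "boolfun set" where
  "projections = {mk n (\<lambda>a. a ! i) | n i. n \<ge> 1 \<and> i < n}"

definition constants :: "boolfun set" where
  "constants = {mk n (\<lambda>a. c) | n c. n \<ge> 1}"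

definition clone :: "boolfun set \<Rightarrow> bool" where
  "clone C \<longleftrightarrow> C \<subseteq> boolfuns \<and> projections \<subseteq> C \<and> comp_set C C \<subseteq> C"

definition clonoid :: "boolfun set \<Rightarrow> boolfun set \<Rightarrow> boolfun set \<Rightarrow> bool" where
  "clonoid C\<^sub>1 C\<^sub>2 K \<longleftrightarrow> K \<subseteq> boolfuns \<and> comp_set K C\<^sub>1 \<subseteq> K \<and> comp_set C\<^sub>2 K \<subseteq> K"

definition clone_generated :: "boolfun set \<Rightarrow> boolfun set" where
  "clone_generated F = \<Inter>{C. clone C \<and> F \<subseteq> C}"

definition clone_I :: "boolfun set" where
  "clone_I = projections \<union> constants"

definition clone_V :: "boolfun set" where
  "clone_V = clone_generated (insert (mk 2 (\<lambda>a. a ! 0 \<or> a ! 1)) constants)"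

definition clone_V0 :: "boolfun set" where
  "clone_V0 = {f \<in> clone_V. app f (zeros (arity f)) = False}"

definition clone_Lambda :: "boolfun set" where
  "clone_Lambda = clone_generated (insert (mk 2 (\<lambda>a. a ! 0 \<and> a ! 1)) constants)"

definition clone_Lambda1 :: "boolfun set" where
  "clone_Lambda1 = {f \<in> clone_Lambda. app f (ones (arity f)) = True}"

definition clone_M :: "boolfun set" where
  "clone_M = {f \<in> boolfuns. \<forall>a\<in>cube (arity f). \<forall>b\<in>cube (arity f).
     list_all2 (\<le>) a b \<longrightarrow> app f a \<le> app f b}"

definition meet :: "nat \<Rightarrow> bool list set \<Rightarrow> bool list" where
  "meet n T = map (\<lambda>i. \<forall>a\<in>T. a ! i) [0..<n]"

definition join :: "nat \<Rightarrow> bool list set \<Rightarrow> bool list" where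
  "join n T = map (\<lambda>i. \<exists>a\<in>T. a ! i) [0..<n]"

definition U_inf :: "boolfun set" where
  "U_inf = {f \<in> boolfuns. \<forall>T \<subseteq> {a \<in> cube (arity f). app f a = True}.
     meet (arity f) T \<noteq> zeros (arity f)}"

definition W_inf :: "boolfun set" where
  "W_inf = {f \<in> boolfuns. \<forall>F \<subseteq> {a \<in> cube (arity f). app f a = False}.
     join (arity f) F \<noteq> ones (arity f)}"

definition MU_inf01 :: "boolfun set" where
  "MU_inf01 = {f \<in> clone_M \<inter> U_inf.
     app f (zeros (arity f)) = False \<and> app f (ones (arity f)) = True}"

definition MW_inf01 :: "boolfun set" where
  "MW_inf01 = {f \<in> clone_M \<inter> W_inf.
     app f (zeros (arity f)) = False \<and> app f (ones (arity f)) = True}"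

end

theory Submission
  imports Defs
begin

text \<open>
  Say that \<open>K\<close> is closed under \<open>x \<and> (y \<or> z)\<close>. Then an \<open>n\<close>-ary \<open>f \<noteq> 0\<close> belongs to \<open>K\<close> as soon as it
  lies below some member of \<open>K\<close> and any \<open>a\<close>, \<open>b\<close> with \<open>f a = 1\<close>, \<open>f b = 0\<close> are separated in the
  same way by some member of \<open>K\<close>, by finite distributivity. Separation of \<open>a\<close> from \<open>b\<close> only depends on the set of pairs
  \<open>(a\<^sub>i, b\<^sub>i)\<close>, so it is witnessed by functions of arity at most \<open>4\<close>. Upper bounds come from unary
  functions: inside \<open>K\<close>, every \<open>f\<close> is below some \<open>f(u\<^sub>1, \<dots>, u\<^sub>n)(v)\<close> with unary \<open>u\<^sub>i\<close> and an \<open>n\<close>-ary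
  \<open>v\<close> from \<open>C\<^sub>1\<close>. Hence a clonoid is determined by its members of arity at most \<open>4\<close>.

  The dual cases are treated simultaneously by means of truth values \<open>c\<close> (for \<open>C\<^sub>1\<close>) and \<open>d\<close>
  (for \<open>C\<^sub>2\<close>).
\<close>

section \<open>Boolean functions of bounded arity and their composites\<close>

lemma finite_cube: "finite (cube n)"
  using finite_lists_length_eq[of "UNIV :: bool set" n] by (simp add: cube_def)

lemma fst_mk [simp]: "fst (mk n f) = n"
  by (simp add: mk_def)

lemma app_mk [simp]: "length a = n \<Longrightarrow> app (mk n f) a = f a"
  by (simp add: mk_def cube_def)

lemma mk_in_boolfuns [simp]: "mk n f \<in> boolfuns \<longleftrightarrow> n \<ge> 1"
  by (simp add: mk_def boolfuns_def)

lemma mk_app: "f \<in> boolfuns \<Longrightarrow> arity f = n \<Longrightarrow> mk n (app f) = f"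
  by (auto simp: mk_def boolfuns_def extensional_restrict)

lemma mk_cong: "(\<And>a. length a = n \<Longrightarrow> f a = g a) \<Longrightarrow> mk n f = mk n g"
  by (auto simp: mk_def cube_def fun_eq_iff restrict_def)

lemma boolfun_eqI:
  assumes "f \<in> boolfuns" "g \<in> boolfuns" "arity f = arity g"
    and "\<And>a. length a = arity g \<Longrightarrow> app f a = app g a"
  shows "f = g"
  using assms mk_app mk_cong by metis

lemma finite_boolfuns_arity_le: "finite {f \<in> boolfuns. arity f \<le> k}"
proof (rule finite_subset)
  show "{f \<in> boolfuns. arity f \<le> k} \<subseteq> (SIGMA n:{..k}. cube n \<rightarrow>\<^sub>E UNIV)"
    by (auto simp: boolfuns_def PiE_def)
  show "finite (SIGMA n:{..k}. cube n \<rightarrow>\<^sub>E (UNIV :: bool set))"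
    by (intro finite_SigmaI finite_atMost finite_PiE finite_cube) simp
qed

lemma comp_setI:
  assumes "f \<in> F" and "\<And>i. i < arity f \<Longrightarrow> mk m (h i) \<in> G"
  shows "mk m (\<lambda>x. app f (map (\<lambda>i. h i x) [0..<arity f])) \<in> comp_set F G"
proof -
  let ?gs = "map (\<lambda>i. mk m (h i)) [0..<arity f]"
  have "compose_bf m f ?gs \<in> comp_set F G"
    unfolding comp_set_def mem_Collect_eq
    by (intro exI[of _ m] exI[of _ f] exI[of _ ?gs]) (use assms in auto)
  moreover have "compose_bf m f ?gs = mk m (\<lambda>x. app f (map (\<lambda>i. h i x) [0..<arity f]))"
    unfolding compose_bf_def by (rule mk_cong) (simp add: comp_def)
  ultimately show ?thesis by simp
qed

lemma mk_nth_in_projections: "i < n \<Longrightarrow> mk n (\<lambda>a. a ! i) \<in> projections"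
  by (force simp: projections_def)

lemma mk_const_in_constants: "n \<ge> 1 \<Longrightarrow> mk n (\<lambda>a. c) \<in> constants"
  by (force simp: constants_def)

text \<open>Taking \<open>B = C\<close> gives closure under intersection, so finitely many
  separators together with \<open>T\<close> cut out, around each point of \<open>F\<close>, a member
  of \<open>L\<close> inside \<open>F\<close>. The union of these is reached in \<open>L\<close>
  because intersecting it with \<open>T\<close>, which contains \<open>F\<close>, does not change
  it.\<close>

lemma separated_mem:
  assumes cl: "\<And>A B C. A \<in> L \<Longrightarrow> B \<in> L \<Longrightarrow> C \<in> L \<Longrightarrow> A \<inter> (B \<union> C) \<in> L"
    and T: "T \<in> L" "finite T" and F: "F \<subseteq> T" "F \<noteq> {}"
    and sep: "\<And>a b. a \<in> F \<Longrightarrow> b \<in> T - F \<Longrightarrow> \<exists>G\<in>L. a \<in> G \<and> b \<notin> G"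
  shows "F \<in> L"
proof -
  have int: "A \<inter> B \<in> L" if "A \<in> L" "B \<in> L" for A B
    using cl[of A B B] that by simp
  have point: "\<exists>G\<in>L. a \<in> G \<and> G \<subseteq> F" if a: "a \<in> F" for a
  proof -
    have "\<exists>G\<in>L. a \<in> G \<and> G \<subseteq> T \<and> G \<inter> S = {}" if "finite S" "S \<subseteq> T - F" for S
      using that
    proof (induction S rule: finite_induct)
      case empty
      then show ?case using T F a by blast
    next
      case (insert b S)
      then obtain G where "G \<in> L" "a \<in> G" "G \<subseteq> T" "G \<inter> S = {}" by auto
      moreover obtain H where "H \<in> L" "a \<in> H" "b \<notin> H" using sep a insert.prems by blast
      ultimately show ?case using int[of G H] by (intro bexI[of _ "G \<inter> H"]) auto
    qed
    from this[of "T - F"] T(2) show ?thesis by blast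
  qed
  have "\<exists>G\<in>L. S \<subseteq> G \<and> G \<subseteq> F" if "finite S" "S \<noteq> {}" "S \<subseteq> F" for S
    using that
  proof (induction S rule: finite_ne_induct)
    case (singleton a)
    then show ?case using point[of a] by auto
  next
    case (insert a S)
    then obtain G where "G \<in> L" "S \<subseteq> G" "G \<subseteq> F" by auto
    moreover obtain H where "H \<in> L" "a \<in> H" "H \<subseteq> F" using point insert.prems by blast
    ultimately show ?case
      using cl[OF T(1), of G H] F insert.prems by (intro bexI[of _ "T \<inter> (G \<union> H)"]) auto
  qed
  from this[OF finite_subset[OF F(1) T(2)] F(2) subset_refl]
  obtain G where "G \<in> L" "F \<subseteq> G" "G \<subseteq> F" by blast
  then show ?thesis by (simp add: subset_antisym)
qed

section \<open>Clonoids are determined by their members of arity at most 4\<close>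

text \<open>For \<open>d = True\<close> this is \<open>x \<and> (y \<or> z)\<close>, and for \<open>d = False\<close> it is \<open>x \<or> (y \<and> z)\<close>.\<close>

definition meet_join :: "bool \<Rightarrow> boolfun" where
  "meet_join d = mk 3 (\<lambda>a. (a ! 0 = d \<and> (a ! 1 = d \<or> a ! 2 = d)) = d)"

text \<open>An upper bound for \<open>d = True\<close>, a lower bound for \<open>d = False\<close>.
  It factors through the unary function obtained from \<open>f\<close> by substituting the
  \<open>u i\<close>, so inside a clonoid it is visible at arity 1.\<close>

definition covering :: "boolfun set \<Rightarrow> bool \<Rightarrow> bool" where
  "covering C d \<longleftrightarrow> (\<forall>f\<in>boolfuns. \<exists>u v.
     (\<forall>i<arity f. mk 1 (u i) \<in> C) \<and> mk (arity f) v \<in> C \<and>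
     (\<forall>x. length x = arity f \<longrightarrow> app f x = d \<longrightarrow>
        app f (map (\<lambda>i. u i [v x]) [0..<arity f]) = d))"

lemma clonoid_subst:
  assumes "clonoid C\<^sub>1 C\<^sub>2 K" "f \<in> K" "\<And>i. i < arity f \<Longrightarrow> mk m (h i) \<in> C\<^sub>1"
  shows "mk m (\<lambda>x. app f (map (\<lambda>i. h i x) [0..<arity f])) \<in> K"
  using assms comp_setI[of f K m h C\<^sub>1] unfolding clonoid_def by blast

lemma clonoid_meet_join:
  assumes K: "clonoid C\<^sub>1 C\<^sub>2 K" and C2: "meet_join d \<in> C\<^sub>2"
    and f: "mk m f \<in> K" "mk m g \<in> K" "mk m h \<in> K"
  shows "mk m (\<lambda>x. (f x = d \<and> (g x = d \<or> h x = d)) = d) \<in> K"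
proof -
  have ar: "arity (meet_join d) = 3" by (simp add: meet_join_def)
  have "mk m ([f, g, h] ! i) \<in> K" if "i < 3" for i
    using that f by (auto simp: numeral_3_eq_3 less_Suc_eq)
  then have "mk m (\<lambda>x. app (meet_join d) (map (\<lambda>i. ([f, g, h] ! i) x) [0..<3])) \<in> comp_set C\<^sub>2 K"
    using comp_setI[OF C2, of m "\<lambda>i. [f, g, h] ! i" K] ar by simp
  moreover have "mk m (\<lambda>x. app (meet_join d) (map (\<lambda>i. ([f, g, h] ! i) x) [0..<3]))
      = mk m (\<lambda>x. (f x = d \<and> (g x = d \<or> h x = d)) = d)"
    by (rule mk_cong) (simp add: meet_join_def upt_rec)
  ultimately show ?thesis using K unfolding clonoid_def by auto
qed

text \<open>Identifying coordinates \<open>i\<close> with equal pairs \<open>(a ! i, b ! i)\<close>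
  turns \<open>f\<close> into a minor of arity at most 4, which lies in \<open>K'\<close>.
  Reinserting a representative coordinate for each pair keeps the values at \<open>a\<close> and
  \<open>b\<close>.\<close>

lemma clonoid_separation_transfer:
  assumes K: "clonoid C\<^sub>1 C\<^sub>2 K" and K': "clonoid C\<^sub>1 C\<^sub>2 K'"
    and C1: "projections \<subseteq> C\<^sub>1" and low: "{g \<in> K. arity g \<le> 4} \<subseteq> K'"
    and f: "f \<in> K" and ab: "length a = arity f" "length b = arity f"
  shows "\<exists>g\<in>K'. arity g = arity f \<and> app g a = app f a \<and> app g b = app f b"
proof -
  let ?n = "arity f"
  define P where "P = remdups (zip a b)"
  let ?k = "length P"
  have setP: "set P = set (zip a b)" by (simp add: P_def)
  have "?k = card (set P)" by (simp add: P_def length_remdups_card_conv)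
  also have "\<dots> \<le> card (UNIV :: (bool \<times> bool) set)" by (rule card_mono) auto
  also have "\<dots> = 4" by (simp add: card_UNIV_bool card_cartesian_product flip: UNIV_Times_UNIV)
  finally have k: "?k \<le> 4" .
  have "\<exists>j<?k. P ! j = (a ! i, b ! i)" if "i < ?n" for i
  proof -
    have "(a ! i, b ! i) \<in> set P" unfolding setP using that ab by (force simp: set_zip)
    then show ?thesis by (simp add: in_set_conv_nth)
  qed
  \<comment> \<open>\<open>p i\<close> is the index of the pair at coordinate \<open>i\<close>;
    \<open>q\<close> below selects a coordinate for each index.\<close>
  then obtain p where p: "\<And>i. i < ?n \<Longrightarrow> p i < ?k \<and> P ! p i = (a ! i, b ! i)" by metis
  have "\<exists>i<?n. P ! j = (a ! i, b ! i)" if "j < ?k" for j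
  proof -
    have "P ! j \<in> set (zip a b)" using that setP nth_mem by metis
    then show ?thesis using ab by (auto simp: set_zip)
  qed
  then obtain q where q: "\<And>j. j < ?k \<Longrightarrow> q j < ?n \<and> P ! j = (a ! q j, b ! q j)" by metis
  let ?h = "mk ?k (\<lambda>x. app f (map (\<lambda>i. x ! p i) [0..<?n]))"
  have "?h \<in> K"
    by (rule clonoid_subst[OF K f]) (use p C1 mk_nth_in_projections in blast)
  then have "?h \<in> K'" using low k by auto
  let ?g = "mk ?n (\<lambda>y. app ?h (map (\<lambda>j. y ! q j) [0..<?k]))"
  have "?g \<in> K'"
    by (rule clonoid_subst[OF K' \<open>?h \<in> K'\<close>, unfolded fst_mk])
      (use q C1 mk_nth_in_projections in blast)
  moreover have "app ?g a = app f a"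
  proof -
    \<comment> \<open>Coordinates \<open>i\<close> and \<open>q (p i)\<close> carry the same pair,
      so \<open>a\<close> is reproduced, and likewise \<open>b\<close> below.\<close>
    have "map (\<lambda>i. map (\<lambda>j. a ! q j) [0..<?k] ! p i) [0..<?n] = a"
      using ab p q by (intro nth_equalityI) (simp, simp, metis prod.inject)
    then show ?thesis using ab by simp
  qed
  moreover have "app ?g b = app f b"
  proof -
    have "map (\<lambda>i. map (\<lambda>j. b ! q j) [0..<?k] ! p i) [0..<?n] = b"
      using ab p q by (intro nth_equalityI) (simp, simp, metis prod.inject)
    then show ?thesis using ab by simp
  qed
  ultimately show ?thesis by (intro bexI[of _ ?g]) simp_all
qed

text \<open>The unary function in the covering passes from \<open>K\<close> to \<open>K'\<close> by
  its low arity; \<open>v\<close> is then substituted inside \<open>K'\<close>.\<close>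

lemma clonoid_bound_transfer:
  assumes K: "clonoid C\<^sub>1 C\<^sub>2 K" and K': "clonoid C\<^sub>1 C\<^sub>2 K'"
    and cov: "covering C\<^sub>1 d" and low: "{g \<in> K. arity g \<le> 4} \<subseteq> K'"
    and f: "f \<in> K"
  shows "\<exists>t\<in>K'. arity t = arity f \<and> (\<forall>x. length x = arity f \<longrightarrow> app f x = d \<longrightarrow> app t x = d)"
proof -
  let ?n = "arity f"
  have "f \<in> boolfuns" using K f unfolding clonoid_def by blast
  then obtain u v where u: "\<And>i. i < ?n \<Longrightarrow> mk 1 (u i) \<in> C\<^sub>1" and v: "mk ?n v \<in> C\<^sub>1"
    and uv: "\<And>x. length x = ?n \<Longrightarrow> app f x = d \<Longrightarrow> app f (map (\<lambda>i. u i [v x]) [0..<?n]) = d"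
    using cov unfolding covering_def by blast
  let ?h = "mk 1 (\<lambda>x. app f (map (\<lambda>i. u i x) [0..<?n]))"
  have "?h \<in> K" using clonoid_subst[OF K f u] .
  then have "?h \<in> K'" using low by auto
  then have "mk ?n (\<lambda>x. app ?h (map (\<lambda>i. v x) [0..<1])) \<in> K'"
    using clonoid_subst[OF K', of ?h ?n "\<lambda>_. v"] v by simp
  then show ?thesis by (rule bexI[rotated]) (simp add: uv)
qed

text \<open>\<open>separated_mem\<close> is applied to the sets where the members of
  \<open>K'\<close> of the arity of \<open>f\<close> take the value \<open>d\<close>; the two
  transfer lemmas supply \<open>T\<close> and the separators.\<close>

lemma clonoid_low_arity:
  assumes K: "clonoid C\<^sub>1 C\<^sub>2 K" and K': "clonoid C\<^sub>1 C\<^sub>2 K'"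
    and C1: "projections \<subseteq> C\<^sub>1" "covering C\<^sub>1 d" and C2: "meet_join d \<in> C\<^sub>2"
    and low: "{g \<in> K. arity g \<le> 4} \<subseteq> K'"
    and f: "f \<in> K"
  shows "f \<in> K'"
proof -
  let ?n = "arity f"
  have KB: "K \<subseteq> boolfuns" "K' \<subseteq> boolfuns" using K K' unfolding clonoid_def by auto
  define F where "F = {x \<in> cube ?n. app f x = d}"
  define L where "L = {{x \<in> cube ?n. app g x = d} | g. g \<in> K' \<and> arity g = ?n}"
  have level: "{x \<in> cube ?n. app g x = d} \<in> L" if "g \<in> K'" "arity g = ?n" for g
    unfolding L_def mem_Collect_eq by (rule exI[of _ g]) (simp add: that)
  show ?thesis
  proof (cases "F = {}")
    \<comment> \<open>Here \<open>f\<close> is constantly \<open>\<not> d\<close>, and is recovered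
      from its unary minor by adding dummy variables.\<close>
    case True
    have n: "?n \<ge> 1" using f KB by (auto simp: boolfuns_def)
    have proj: "mk m (\<lambda>x. x ! 0) \<in> C\<^sub>1" if "m \<ge> 1" for m
      using that C1(1) mk_nth_in_projections[of 0 m] by auto
    let ?h = "mk 1 (\<lambda>x. app f (map (\<lambda>i. x ! 0) [0..<?n]))"
    have "?h \<in> K" using clonoid_subst[OF K f, of 1 "\<lambda>i x. x ! 0"] proj by simp
    then have "?h \<in> K'" using low by auto
    then have "mk ?n (\<lambda>x. app ?h (map (\<lambda>i. x ! 0) [0..<1])) \<in> K'"
      using clonoid_subst[OF K', of ?h ?n "\<lambda>i x. x ! 0"] n proj by simp
    moreover have "mk ?n (\<lambda>x. app ?h (map (\<lambda>i. x ! 0) [0..<1])) = f"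
      by (rule boolfun_eqI) (use n f KB True in \<open>auto simp: F_def cube_def\<close>)
    ultimately show ?thesis by simp
  next
    case False
    obtain t where t: "t \<in> K'" "arity t = ?n"
      "\<forall>x. length x = ?n \<longrightarrow> app f x = d \<longrightarrow> app t x = d"
      using clonoid_bound_transfer[OF K K' C1(2) low f] by (elim bexE conjE) (rule that)
    have "F \<in> L"
    proof (rule separated_mem[where T = "{x \<in> cube ?n. app t x = d}"])
      show "{x \<in> cube ?n. app t x = d} \<in> L" using level t by simp
      show "finite {x \<in> cube ?n. app t x = d}" by (simp add: finite_cube)
      show "F \<subseteq> {x \<in> cube ?n. app t x = d}" using t by (auto simp: F_def cube_def)
      show "F \<noteq> {}" by fact
      show "A \<inter> (B \<union> C) \<in> L" if mem: "A \<in> L" "B \<in> L" "C \<in> L" for A B C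
      proof -
        obtain p q r where pqr: "p \<in> K'" "q \<in> K'" "r \<in> K'" "arity p = ?n" "arity q = ?n" "arity r = ?n"
          and ABC: "A = {x \<in> cube ?n. app p x = d}" "B = {x \<in> cube ?n. app q x = d}"
            "C = {x \<in> cube ?n. app r x = d}"
          using mem unfolding L_def mem_Collect_eq by (elim exE conjE) (rule that)
        \<comment> \<open>For either \<open>d\<close>, the value is \<open>d\<close> exactly when
          the condition in parentheses holds.\<close>
        let ?s = "mk ?n (\<lambda>x. (app p x = d \<and> (app q x = d \<or> app r x = d)) = d)"
        have "mk ?n (app g) \<in> K'" if "g \<in> K'" "arity g = ?n" for g
          using that KB mk_app[of g ?n] by auto
        then have "?s \<in> K'" using clonoid_meet_join[OF K' C2] pqr by blast
        moreover have "A \<inter> (B \<union> C) = {x \<in> cube ?n. app ?s x = d}"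
          unfolding ABC by (auto simp: cube_def)
        ultimately show ?thesis using level[of ?s] by simp
      qed
      show "\<exists>G\<in>L. a \<in> G \<and> b \<notin> G" if "a \<in> F" "b \<in> {x \<in> cube ?n. app t x = d} - F" for a b
      proof -
        have ab: "length a = ?n" "length b = ?n" "app f a = d" "app f b \<noteq> d"
          using that by (auto simp: F_def cube_def)
        obtain g where "g \<in> K'" "arity g = ?n" "app g a = app f a" "app g b = app f b"
          using clonoid_separation_transfer[OF K K' C1(1) low f ab(1,2)] by (elim bexE conjE) (rule that)
        then show ?thesis
          using ab by (intro bexI[OF _ level[of g]]) (simp_all add: cube_def)
      qed
    qed
    obtain g where g: "g \<in> K'" "arity g = ?n" "F = {x \<in> cube ?n. app g x = d}"
      using \<open>F \<in> L\<close> unfolding L_def mem_Collect_eq by (elim exE conjE) (rule that)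
    have "f = g"
    proof (rule boolfun_eqI)
      fix x :: "bool list" assume "length x = arity g"
      then show "app f x = app g x"
        using g(2,3) unfolding F_def cube_def set_eq_iff by (cases d) auto
    qed (use f g KB in auto)
    then show ?thesis using g by simp
  qed
qed

text \<open>Restriction to arity at most 4 is injective on clonoids and takes values in the power
  set of a finite set.\<close>

lemma finite_clonoids:
  assumes "projections \<subseteq> C\<^sub>1" "covering C\<^sub>1 d" "meet_join d \<in> C\<^sub>2"
  shows "finite {K. clonoid C\<^sub>1 C\<^sub>2 K}"
proof (rule finite_imageD)
  let ?r = "\<lambda>K. K \<inter> {f \<in> boolfuns. arity f \<le> 4}"
  show "finite (?r ` {K. clonoid C\<^sub>1 C\<^sub>2 K})"
    by (rule finite_subset[of _ "Pow {f \<in> boolfuns. arity f \<le> 4}"])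
      (auto simp: finite_boolfuns_arity_le)
  show "inj_on ?r {K. clonoid C\<^sub>1 C\<^sub>2 K}"
  proof (rule inj_onI)
    fix K K' assume *: "K \<in> {K. clonoid C\<^sub>1 C\<^sub>2 K}" "K' \<in> {K. clonoid C\<^sub>1 C\<^sub>2 K}" "?r K = ?r K'"
    then have KB: "K \<subseteq> boolfuns" "K' \<subseteq> boolfuns" unfolding clonoid_def by auto
    have low: "{g \<in> K. arity g \<le> 4} \<subseteq> K'" "{g \<in> K'. arity g \<le> 4} \<subseteq> K"
      using *(3) KB by blast+
    show "K = K'"
    proof
      show "K \<subseteq> K'"
        using clonoid_low_arity[of C\<^sub>1 C\<^sub>2 K K' d] * assms low by blast
      show "K' \<subseteq> K"
        using clonoid_low_arity[of C\<^sub>1 C\<^sub>2 K' K d] * assms low by blast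
    qed
  qed
qed

section \<open>The covering condition for the three choices of \<open>K\<^sub>1\<close>\<close>

lemma covering_constants:
  assumes "constants \<subseteq> C"
  shows "covering C d"
  unfolding covering_def
proof
  fix f :: boolfun assume f: "f \<in> boolfuns"
  then have n: "arity f \<ge> 1" by (auto simp: boolfuns_def)
  have const: "mk m (\<lambda>_. c) \<in> C" if "m \<ge> 1" for m c
    using assms mk_const_in_constants that by blast
  \<comment> \<open>A point where \<open>f\<close> takes the value \<open>d\<close>; if there is
    none, any point will do. Its coordinates become the constants \<open>u i\<close>.\<close>
  obtain a where a: "length a = arity f"
    "\<And>x. length x = arity f \<Longrightarrow> app f x = d \<Longrightarrow> app f a = d"
    by (metis length_replicate)
  have "map ((!) a) [0..<arity f] = a" using a(1) map_nth by metis
  then show "\<exists>u v. (\<forall>i<arity f. mk 1 (u i) \<in> C) \<and> mk (arity f) v \<in> C \<and>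
     (\<forall>x. length x = arity f \<longrightarrow> app f x = d \<longrightarrow>
        app f (map (\<lambda>i. u i [v x]) [0..<arity f]) = d)"
    using n a const by (intro exI[of _ "\<lambda>i _. a ! i"] exI[of _ "\<lambda>_. False"]) auto
qed

text \<open>
  \<open>(\<exists>i<n. x ! i = c) = c\<close> is the disjunction of the variables for \<open>c = True\<close> and their
  conjunction for \<open>c = False\<close>.
\<close>

lemma covering_fold:
  assumes proj: "projections \<subseteq> C" and const: "\<And>n. n \<ge> 1 \<Longrightarrow> mk n (\<lambda>_. \<not> c) \<in> C"
    and fold: "\<And>n. n \<ge> 1 \<Longrightarrow> mk n (\<lambda>x. (\<exists>i<n. x ! i = c) = c) \<in> C"
  shows "covering C d"
  unfolding covering_def
proof
  fix f :: boolfun assume "f \<in> boolfuns"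
  let ?n = "arity f"
  have n: "?n \<ge> 1" using \<open>f \<in> boolfuns\<close> by (auto simp: boolfuns_def)
  let ?z = "replicate ?n (\<not> c)"
  have z: "map (\<lambda>i. \<not> c) [0..<?n] = ?z" by (simp add: map_replicate_const)
  have id: "mk 1 (\<lambda>x. x ! 0) \<in> C" using proj mk_nth_in_projections by auto
  show "\<exists>u v. (\<forall>i<?n. mk 1 (u i) \<in> C) \<and> mk ?n v \<in> C \<and>
     (\<forall>x. length x = ?n \<longrightarrow> app f x = d \<longrightarrow> app f (map (\<lambda>i. u i [v x]) [0..<?n]) = d)"
  proof (cases "app f ?z = d")
    case True
    then show ?thesis
      using n const z by (intro exI[of _ "\<lambda>i _. \<not> c"] exI[of _ "\<lambda>_. \<not> c"]) auto
  next
    case False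
    obtain a where a: "length a = ?n" "\<And>x. length x = ?n \<Longrightarrow> app f x = d \<Longrightarrow> app f a = d"
      by (metis length_replicate)
    \<comment> \<open>If \<open>f x = d\<close>, then \<open>x\<close> has a coordinate
      \<open>c\<close>, so \<open>v x = c\<close>, and the \<open>u i\<close> send \<open>c\<close>
      to the coordinates of \<open>a\<close>.\<close>
    define u where "u = (\<lambda>i x. if a ! i = c then x ! 0 else \<not> c)"
    define v where "v = (\<lambda>x. (\<exists>i<?n. x ! i = c) = c)"
    have "mk 1 (u i) \<in> C" for i
      unfolding u_def using id const[of 1] by (cases "a ! i = c") auto
    moreover have "mk ?n v \<in> C" unfolding v_def using fold n by simp
    moreover have "app f (map (\<lambda>i. u i [v x]) [0..<?n]) = d"
      if x: "length x = ?n" "app f x = d" for x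
    proof -
      have "x \<noteq> ?z" using x False by auto
      then have "\<exists>i<?n. x ! i = c" using x(1) by (auto simp: list_eq_iff_nth_eq)
      then have "v x = c" by (simp add: v_def)
      then have "map (\<lambda>i. u i [v x]) [0..<?n] = a"
        using a(1) by (auto simp: u_def list_eq_iff_nth_eq)
      then show ?thesis using a x by simp
    qed
    ultimately show ?thesis by blast
  qed
qed

text \<open>Induction on \<open>k\<close> with \<open>n\<close> fixed, since composition needs inner
  functions of a common arity. The empty fold is the constant \<open>\<not> c\<close>.\<close>

lemma clone_fold:
  assumes C: "clone C" and const: "constants \<subseteq> C"
    and binary: "mk 2 (\<lambda>a. (a ! 0 = c \<or> a ! 1 = c) = c) \<in> C"
    and "k \<le> n" "n \<ge> 1"
  shows "mk n (\<lambda>x. (\<exists>i<k. x ! i = c) = c) \<in> C"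
  using \<open>k \<le> n\<close>
proof (induction k)
  case 0
  then show ?case using const mk_const_in_constants[of n "\<not> c"] \<open>n \<ge> 1\<close> by auto
next
  case (Suc k)
  let ?b = "mk 2 (\<lambda>a. (a ! 0 = c \<or> a ! 1 = c) = c)"
  let ?h = "\<lambda>j x. if j = 0 then (\<exists>i<k. x ! i = c) = c else x ! k"
  have "mk n (\<lambda>x. x ! k) \<in> C"
    using C Suc.prems mk_nth_in_projections unfolding clone_def by auto
  then have "mk n (?h j) \<in> C" for j using Suc by (cases "j = 0") auto
  then have "mk n (\<lambda>x. app ?b (map (\<lambda>j. ?h j x) [0..<2])) \<in> C"
    using comp_setI[OF binary, of n ?h C] C unfolding clone_def by auto
  also have "mk n (\<lambda>x. app ?b (map (\<lambda>j. ?h j x) [0..<2])) = mk n (\<lambda>x. (\<exists>i<Suc k. x ! i = c) = c)"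
    by (rule mk_cong) (auto simp: upt_rec less_Suc_eq)
  finally show ?case .
qed

text \<open>The constant 0 and the disjunction of all variables both vanish at the zero
  tuple.\<close>

lemma covering_clone_V0:
  assumes "clone C" "clone_V0 \<subseteq> C"
  shows "covering C d"
proof (rule covering_fold[where c = True])
  show "projections \<subseteq> C" using assms unfolding clone_def by blast
  show "mk n (\<lambda>_. \<not> True) \<in> C" if "n \<ge> 1" for n
    using that mk_const_in_constants[of n False]
    by (intro subsetD[OF assms(2)]) (auto simp: clone_V0_def clone_V_def clone_generated_def zeros_def)
  show "mk n (\<lambda>x. (\<exists>i<n. x ! i = True) = True) \<in> C" if "n \<ge> 1" for n
  proof -
    have "mk n (\<lambda>x. (\<exists>i<n. x ! i = True) = True) \<in> clone_V"
      unfolding clone_V_def clone_generated_def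
      using that clone_fold[where c = True and k = n and n = n] by auto
    then show ?thesis using that by (intro subsetD[OF assms(2)]) (auto simp: clone_V0_def zeros_def)
  qed
qed

lemma covering_clone_Lambda1:
  assumes "clone C" "clone_Lambda1 \<subseteq> C"
  shows "covering C d"
proof (rule covering_fold[where c = False])
  show "projections \<subseteq> C" using assms unfolding clone_def by blast
  show "mk n (\<lambda>_. \<not> False) \<in> C" if "n \<ge> 1" for n
    using that mk_const_in_constants[of n True]
    by (intro subsetD[OF assms(2)])
      (auto simp: clone_Lambda1_def clone_Lambda_def clone_generated_def ones_def)
  show "mk n (\<lambda>x. (\<exists>i<n. x ! i = False) = False) \<in> C" if "n \<ge> 1" for n
  proof -
    have "mk n (\<lambda>x. (\<exists>i<n. x ! i = False) = False) \<in> clone_Lambda"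
      unfolding clone_Lambda_def clone_generated_def
      using that clone_fold[where c = False and k = n and n = n] by auto
    then show ?thesis using that by (intro subsetD[OF assms(2)]) (auto simp: clone_Lambda1_def ones_def)
  qed
qed

section \<open>The ternary operations that \<open>K\<^sub>2\<close> provides\<close>

lemma meet_join_in_clone_M: "meet_join d \<in> clone_M"
  by (cases d) (auto simp: meet_join_def clone_M_def cube_def list_all2_conv_all_nth)

lemma meet_join_True_in_MU: "meet_join True \<in> MU_inf01"
proof -
  have "meet 3 T \<noteq> zeros 3" if "T \<subseteq> {a \<in> cube 3. app (meet_join True) a}" for T
  proof -
    \<comment> \<open>Every point of \<open>T\<close> has first coordinate 1, hence so does the
      meet, even for empty \<open>T\<close>.\<close>
    have "meet 3 T ! 0 \<noteq> zeros 3 ! 0"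
      using that by (auto simp: meet_def zeros_def meet_join_def cube_def)
    then show ?thesis by metis
  qed
  then have "meet_join True \<in> U_inf" by (simp add: U_inf_def meet_join_def)
  then show ?thesis
    using meet_join_in_clone_M[of True] by (simp add: MU_inf01_def meet_join_def zeros_def ones_def)
qed

lemma meet_join_False_in_MW: "meet_join False \<in> MW_inf01"
proof -
  have "join 3 T \<noteq> ones 3" if "T \<subseteq> {a \<in> cube 3. \<not> app (meet_join False) a}" for T
  proof -
    have "join 3 T ! 0 \<noteq> ones 3 ! 0"
      using that by (auto simp: join_def ones_def meet_join_def cube_def)
    then show ?thesis by metis
  qed
  then have "meet_join False \<in> W_inf" by (simp add: W_inf_def meet_join_def)
  then show ?thesis
    using meet_join_in_clone_M[of False] by (simp add: MW_inf01_def meet_join_def zeros_def ones_def)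
qed

theorem theorem6p1:
  fixes C\<^sub>1 C\<^sub>2 :: "boolfun set"
  assumes "clone C\<^sub>1" and "clone C\<^sub>2"
    and "\<exists>K\<^sub>1\<in>{clone_I, clone_V0, clone_Lambda1}. K\<^sub>1 \<subseteq> C\<^sub>1"
    and "\<exists>K\<^sub>2\<in>{MU_inf01, MW_inf01}. K\<^sub>2 \<subseteq> C\<^sub>2"
  shows "finite {K. clonoid C\<^sub>1 C\<^sub>2 K}"
proof -
  \<comment> \<open>Covering holds for both values of \<open>d\<close>, so \<open>C\<^sub>2\<close>
    alone decides which one is used.\<close>
  have "covering C\<^sub>1 d" for d
    using assms(1,3) covering_constants covering_clone_V0 covering_clone_Lambda1
    by (auto simp: clone_I_def)
  moreover have "projections \<subseteq> C\<^sub>1" using assms(1) unfolding clone_def by blast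
  moreover obtain d where "meet_join d \<in> C\<^sub>2"
    using assms(4) meet_join_True_in_MU meet_join_False_in_MW by blast
  ultimately show ?thesis using finite_clonoids by blast
qed

end
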